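(* Let $n\geq 2$, $m\geq 1$ be integers and let $L\in\mathcal{L}_{n,m}$. Then $$\rho_{n,L}=\frac{|PR_n(L)|}{|UD_n(L)|}\;\geq\; q_{n,m}\cdot\varsigma_{n,m}^{\,m-1},$$ where $$q_{n,m}:=\begin{cases}1,& n\geq m,\\ \dfrac{(m-1)!}{(m-1)^{m-1}},& n<m,\end{cases}\qquad \varsigma_{n,m}:=\frac{n-(m)_{n-1}}{n^{\lfloor \frac{m}{n-1}\rfloor+1}},$$ and $(m)_{n-1}$ is the remainder from the division of $m$ by $n-1$. Moreover, if the sequence $L$ is injective (i.e. all values in $L$ are distinct), then $$\rho_{n,L}\geq \varpi_{n,m}:=\left(1-\frac{1-n^{-1}}{n-1}\right)\left(1-\frac{1-n^{-2}}{n-1}\right)\cdots\left(1-\frac{1-n^{-m+1}}{n-1}\right)=\prod_{i=1}^{m-1}\left(1-\frac{1-n^{-i}}{n-1}\right).$$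
   Context: Let $X$ be a finite alphabet with $n\ge 2$ letters. A code with length distribution $L=(a_1,\ldots,a_m)$, where the $a_i$ are positive integers, is a finite sequence $(v_1,\ldots,v_m)$ of words $v_i\in X^*$ with $|v_i|=a_i$ for all $i$. A code is a prefix code if it is an injective sequence of non-empty words such that no $v_i$ is a prefix (initial segment) of another code word $v_j$, $j\ne i$. A code $(v_1,\ldots,v_m)$ is uniquely decodable if $v_{i_1}v_{i_2}\cdots v_{i_t}=v_{j_1}v_{j_2}\cdots v_{j_{t'}}$ with $t,t'\geq 1$ and all indices in $\{1,\ldots,m\}$ implies $t=t'$ and $i_s=j_s$ for every $1\leq s\leq t$. $UD_n(L)$ denotes the set of uniquely decodable codes over an $n$-letter alphabet with length distribution $L$, and $PR_n(L)\subseteq UD_n(L)$ the subset of prefix codes. $\mathcal{L}_{n,m}$ is the set of sequences $L$ of positive integers of length $|L|=m$ with $UD_n(L)\neq\emptyset$ (equivalently, by Kraft-McMillan, $PR_n(L)\ne\emptyset$, equivalently $\sum_{i=1}^m n^{-a_i}\leq 1$). The empty product equals $1$. *)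

theory Defs
  imports Complex_Main "HOL-Library.Sublist"
begin

definition codes :: "'a set \<Rightarrow> nat list \<Rightarrow> 'a list list set" where
  "codes X L = {v. length v = length L \<and>
     (\<forall>i<length L. v ! i \<in> lists X \<and> length (v ! i) = L ! i)}"

definition prefix_code :: "'a list list \<Rightarrow> bool" where
  "prefix_code v \<longleftrightarrow> distinct v \<and> (\<forall>w\<in>set v. w \<noteq> []) \<and>
     (\<forall>i<length v. \<forall>j<length v. i \<noteq> j \<longrightarrow> \<not> prefix (v ! i) (v ! j))"

text \<open>The index sequences are 0-based lists; their equality comprises both equality of the
  lengths and equality of the corresponding entries.\<close>

definition uniquely_decodable :: "'a list list \<Rightarrow> bool" where
  "uniquely_decodable v \<longleftrightarrow>
     (\<forall>is js. is \<noteq> [] \<longrightarrow> js \<noteq> [] \<longrightarrow>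
        set is \<subseteq> {..<length v} \<longrightarrow> set js \<subseteq> {..<length v} \<longrightarrow>
        concat (map (\<lambda>i. v ! i) is) = concat (map (\<lambda>j. v ! j) js) \<longrightarrow> is = js)"

definition UD :: "'a set \<Rightarrow> nat list \<Rightarrow> 'a list list set" where
  "UD X L = {v \<in> codes X L. uniquely_decodable v}"

definition PR :: "'a set \<Rightarrow> nat list \<Rightarrow> 'a list list set" where
  "PR X L = {v \<in> codes X L. prefix_code v}"

definition length_distributions :: "'a set \<Rightarrow> nat \<Rightarrow> nat list set" where
  "length_distributions X m = {L. length L = m \<and> (\<forall>a\<in>set L. a > 0) \<and> UD X L \<noteq> {}}"

definition rho :: "'a set \<Rightarrow> nat list \<Rightarrow> real" where
  "rho X L = real (card (PR X L)) / real (card (UD X L))"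

definition q_coeff :: "nat \<Rightarrow> nat \<Rightarrow> real" where
  "q_coeff n m = (if n \<ge> m then 1 else fact (m - 1) / real (m - 1) ^ (m - 1))"

definition varsigma :: "nat \<Rightarrow> nat \<Rightarrow> real" where
  "varsigma n m = (real n - real (m mod (n - 1))) / real n ^ (m div (n - 1) + 1)"

definition varpi :: "nat \<Rightarrow> nat \<Rightarrow> real" where
  "varpi n m = (\<Prod>i = 1..m - 1. 1 - (1 - 1 / real n ^ i) / (real n - 1))"

end

theory Submission
  imports Defs "HOL-Combinatorics.Permutations"
begin

text \<open>
  Bound \<open>UD\<close> trivially by all codes, of which there are \<open>n\<close> to the sum of the lengths. If the
  lengths are sorted, a prefix code extends by one more word of length \<open>a\<close> in at least \<open>n ^ a\<close>
  times \<open>1 - s\<close> ways, where \<open>s\<close> is the Kraft sum of the words chosen so far. So the ratio is at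
  least the product of the gaps \<open>1 - s\<close> over all proper prefixes of the sorted length sequence,
  and these gaps are positive by McMillan's inequality. The gap after \<open>k\<close> words is least when
  the lengths are chosen greedily (\<open>n - 1\<close> words of length 1, then \<open>n - 1\<close> words of length 2, and
  so on), where it equals \<open>varsigma n k\<close>; for distinct lengths the \<open>k\<close>-th length is at least \<open>k\<close>,
  which makes the gap at least \<open>1 - (1/n + \<dots> + 1/n^k)\<close>.
\<close>

section \<open>Kraft sums of length sequences\<close>

definition kraft_sum :: "nat \<Rightarrow> nat list \<Rightarrow> real" where
  "kraft_sum n L = (\<Sum>a\<leftarrow>L. 1 / real n ^ a)"

lemma kraft_sum_Nil [simp]: "kraft_sum n [] = 0"
  by (simp add: kraft_sum_def)

lemma kraft_sum_append [simp]: "kraft_sum n (L @ M) = kraft_sum n L + kraft_sum n M"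
  by (simp add: kraft_sum_def)

lemma kraft_sum_Cons [simp]: "kraft_sum n (a # L) = 1 / real n ^ a + kraft_sum n L"
  by (simp add: kraft_sum_def)

lemma kraft_sum_nonneg: "kraft_sum n L \<ge> 0"
  by (induction L) auto

lemma kraft_sum_conv_sum: "kraft_sum n L = (\<Sum>i<length L. 1 / real n ^ (L ! i))"
  by (simp add: kraft_sum_def sum_list_sum_nth atLeast0LessThan)

lemma kraft_sum_mset_cong: "mset L = mset M \<Longrightarrow> kraft_sum n L = kraft_sum n M"
  unfolding kraft_sum_def by (metis mset_map sum_mset_sum_list)

subsection \<open>McMillan's inequality\<close>

lemma card_words: "finite X \<Longrightarrow> card {w \<in> lists X. length w = a} = card X ^ a"
  using card_lists_length_eq[of X a] by (simp add: lists_eq_set)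

lemma finite_words: "finite X \<Longrightarrow> finite {w \<in> lists X. length w = a}"
  using finite_lists_length_eq[of X a] by (simp add: lists_eq_set)

text \<open>Expanding the power picks one index from each of the \<open>t\<close> factors. Applied
  to Kraft sums, this produces a sum over index sequences of length \<open>t\<close>.\<close>

lemma power_sum_lists:
  fixes f :: "'b \<Rightarrow> real"
  assumes "finite A"
  shows "sum f A ^ t = (\<Sum>xs | set xs \<subseteq> A \<and> length xs = t. prod_list (map f xs))"
proof (induction t)
  case 0
  have "{xs. set xs \<subseteq> A \<and> length xs = 0} = {[]}" by auto
  then show ?case by simp
next
  case (Suc t)
  let ?B = "{xs. set xs \<subseteq> A \<and> length xs = t}"
  have img: "{xs. set xs \<subseteq> A \<and> length xs = Suc t} = (\<lambda>(x, xs). x # xs) ` (A \<times> ?B)"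
    by (auto simp: length_Suc_conv image_iff)
  have "(\<Sum>xs | set xs \<subseteq> A \<and> length xs = Suc t. prod_list (map f xs))
      = (\<Sum>(x, xs)\<in>A \<times> ?B. f x * prod_list (map f xs))"
    unfolding img by (subst sum.reindex) (auto simp: inj_on_def case_prod_unfold)
  also have "\<dots> = sum f A * (\<Sum>xs\<in>?B. prod_list (map f xs))"
    by (simp add: sum_product sum.cartesian_product)
  finally show ?case using Suc by simp
qed

text \<open>Each length \<open>k <= N\<close> contributes at most 1, since \<open>n ^ k\<close>
  words carry weight \<open>1 / n ^ k\<close> each. It is "at most" because \<open>X\<close> may be
  empty.\<close>

lemma sum_words_le:
  assumes "finite X" "W \<subseteq> {w \<in> lists X. length w \<le> N}"
  shows "(\<Sum>w\<in>W. 1 / real (card X) ^ length w) \<le> real N + 1"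
proof -
  let ?V = "\<lambda>k. {w \<in> lists X. length w = k}"
  have eq: "{w \<in> lists X. length w \<le> N} = (\<Union>k\<in>{..N}. ?V k)" by auto
  have fin: "finite {w \<in> lists X. length w \<le> N}"
    unfolding eq using finite_words[OF assms(1)] by blast
  have "(\<Sum>w\<in>W. 1 / real (card X) ^ length w)
      \<le> (\<Sum>w\<in>{w \<in> lists X. length w \<le> N}. 1 / real (card X) ^ length w)"
    using fin assms(2) by (intro sum_mono2) auto
  also have "\<dots> = (\<Sum>k\<le>N. \<Sum>w\<in>?V k. 1 / real (card X) ^ length w)"
    unfolding eq using finite_words[OF assms(1)] by (intro sum.UNION_disjoint) auto
  also have "\<dots> = (\<Sum>k\<le>N. real (card (?V k)) * (1 / real (card X) ^ k))"
    by (intro sum.cong refl) simp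
  also have "\<dots> \<le> (\<Sum>k\<le>N. 1)"
    by (intro sum_mono) (simp add: card_words[OF assms(1)])
  finally show ?thesis by simp
qed

text \<open>Exponential growth beats linear growth. Squaring Bernoulli's inequality bounds
  \<open>s ^ (2 * t)\<close> below by a quadratic in \<open>t\<close>, which already
  suffices.\<close>

lemma le_one_if_powers_linear:
  fixes s :: real
  assumes "\<And>t::nat. t \<ge> 1 \<Longrightarrow> s ^ t \<le> real t * c + 1" "c \<ge> 0"
  shows "s \<le> 1"
proof (rule ccontr)
  assume "\<not> s \<le> 1"
  then obtain d where d: "s = 1 + d" "d > 0" 
    by (metis diff_gt_0_iff_gt add_diff_cancel_left' diff_add_cancel add.commute not_le)
  \<comment> \<open>Chosen so that \<open>(t * d)\<^sup>2\<close> exceeds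
    \<open>t * (2 * c + 1)\<close>, which dominates the assumed bound at exponent
    \<open>2 * t\<close>.\<close>
  obtain t :: nat where t: "real t * d\<^sup>2 > 2 * c + 1" using reals_Archimedean3[of "d\<^sup>2"] d by auto
  have t1: "t \<ge> 1" using t assms(2) by (cases t) auto
  have "(real t * d)\<^sup>2 \<le> (1 + real t * d)\<^sup>2" using d by (intro power_mono) auto
  also have "\<dots> \<le> (s ^ t)\<^sup>2"
    using Bernoulli_inequality[of d t] d by (intro power_mono) auto
  also have "\<dots> = s ^ (2 * t)" by (simp add: power_mult mult.commute)
  also have "\<dots> \<le> real (2 * t) * c + 1" using t1 by (intro assms(1)) auto
  also have "\<dots> \<le> real t * (2 * c + 1)" using t1 by (simp add: algebra_simps)
  also have "\<dots> < real t * (real t * d\<^sup>2)" using t t1 by (intro mult_strict_left_mono) auto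
  finally show False by (simp add: power2_eq_square algebra_simps)
qed

lemma length_concat_le:
  assumes "\<And>w. w \<in> set ws \<Longrightarrow> length w \<le> M"
  shows "length (concat ws) \<le> length ws * M"
  using assms by (induction ws) (auto simp: add_mono)

text \<open>Unique decodability makes concatenation injective on index sequences of length
  \<open>t\<close>. The \<open>t\<close>-th power of the Kraft sum is thus a sum over distinct words
  of length at most \<open>t * M\<close>, hence linear in \<open>t\<close>.\<close>

theorem McMillan_inequality:
  assumes "finite X" "v \<in> UD X L"
  shows "kraft_sum (card X) L \<le> 1"
proof (rule le_one_if_powers_linear)
  define n where "n = card X"
  \<comment> \<open>The inserted 0 keeps \<open>Max\<close> meaningful for empty
    \<open>L\<close>.\<close>
  define M where "M = Max (insert 0 (set L))"
  have v: "length v = length L" "\<And>i. i < length L \<Longrightarrow> v ! i \<in> lists X"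
    "\<And>i. i < length L \<Longrightarrow> length (v ! i) = L ! i" and ud: "uniquely_decodable v"
    using assms(2) by (auto simp: UD_def codes_def)
  have M: "L ! i \<le> M" if "i < length L" for i
    using that unfolding M_def by (intro Max_ge) auto
  fix t :: nat assume t: "t \<ge> 1"
  let ?I = "{is. set is \<subseteq> {..<length L} \<and> length is = t}"
  let ?e = "\<lambda>is. concat (map (\<lambda>i. v ! i) is)"
  \<comment> \<open>Lengths add under concatenation, so weights multiply.\<close>
  have prod: "prod_list (map (\<lambda>i. 1 / real n ^ (L ! i)) is) = 1 / real n ^ length (?e is)"
    if "set is \<subseteq> {..<length L}" for "is"
    using that by (induction "is") (auto simp: v power_add)
  have inj: "inj_on ?e ?I"
  proof (rule inj_onI)
    fix x y assume "x \<in> ?I" "y \<in> ?I" "?e x = ?e y"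
    moreover from this have "x \<noteq> []" "y \<noteq> []" using t by auto
    ultimately show "x = y" using ud unfolding uniquely_decodable_def v(1) by blast
  qed
  have "kraft_sum n L ^ t = (\<Sum>is\<in>?I. prod_list (map (\<lambda>i. 1 / real n ^ (L ! i)) is))"
    unfolding kraft_sum_conv_sum by (rule power_sum_lists) simp
  also have "\<dots> = (\<Sum>is\<in>?I. 1 / real n ^ length (?e is))"
    by (intro sum.cong refl prod) auto
  also have "\<dots> = (\<Sum>w\<in>?e ` ?I. 1 / real n ^ length w)"
    by (simp add: sum.reindex[OF inj])
  also have "\<dots> \<le> real (t * M) + 1"
    unfolding n_def
  proof (rule sum_words_le[OF assms(1)], safe)
    fix "is" assume "set is \<subseteq> {..<length L}" "t = length is"
    then show "length (?e is) \<le> length is * M"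
      using length_concat_le[of "map (\<lambda>i. v ! i) is" M] M v(3) by fastforce
    fix w x assume "x \<in> set (?e is)"
    then show "x \<in> X" using v(2) \<open>set is \<subseteq> _\<close> by fastforce
  qed
  finally show "kraft_sum (card X) L ^ t \<le> real t * real M + 1" by (simp add: n_def)
qed simp

subsection \<open>Counting codes\<close>

lemma codes_Nil [simp]: "codes X [] = {[]}"
  by (auto simp: codes_def)

lemma codes_snoc:
  "codes X (L @ [a]) = (\<lambda>(v, w). v @ [w]) ` (codes X L \<times> {w \<in> lists X. length w = a})"
proof (intro equalityI subsetI)
  fix u assume u: "u \<in> codes X (L @ [a])"
  then obtain v w where vw: "u = v @ [w]" "length v = length L"
    by (auto simp: codes_def length_Suc_conv_rev)
  have "v ! i \<in> lists X \<and> length (v ! i) = L ! i" if "i < length L" for i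
  proof -
    have "u ! i \<in> lists X \<and> length (u ! i) = (L @ [a]) ! i"
      using u that unfolding codes_def by simp
    then show ?thesis using that vw by (simp add: nth_append)
  qed
  moreover have "u ! length L \<in> lists X \<and> length (u ! length L) = (L @ [a]) ! length L"
    using u unfolding codes_def by simp
  ultimately show "u \<in> (\<lambda>(v, w). v @ [w]) ` (codes X L \<times> {w \<in> lists X. length w = a})"
    using vw by (intro image_eqI[of _ _ "(v, w)"]) (auto simp: codes_def nth_append)
next
  fix u assume "u \<in> (\<lambda>(v, w). v @ [w]) ` (codes X L \<times> {w \<in> lists X. length w = a})"
  then show "u \<in> codes X (L @ [a])"
    by (auto simp: codes_def nth_append less_Suc_eq)
qed

lemma finite_codes: "finite X \<Longrightarrow> finite (codes X L)"
  by (induction L rule: rev_induct) (auto simp: codes_snoc finite_words)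

lemma card_codes:
  assumes "finite X"
  shows "card (codes X L) = card X ^ sum_list L"
proof (induction L rule: rev_induct)
  case (snoc a L)
  have "card (codes X (L @ [a])) = card (codes X L \<times> {w \<in> lists X. length w = a})"
    unfolding codes_snoc by (rule card_image) (auto simp: inj_on_def)
  then show ?case
    using snoc card_words[OF assms] by (simp add: card_cartesian_product power_add)
qed simp

text \<open>Such a word is determined by its last \<open>a - length u\<close> letters. Only an
  inequality holds, as \<open>u\<close> need not be a word over \<open>X\<close>.\<close>

lemma card_words_with_prefix:
  assumes "finite X" "length u \<le> a"
  shows "card {w \<in> lists X. length w = a \<and> prefix u w} \<le> card X ^ (a - length u)"
proof -
  have "{w \<in> lists X. length w = a \<and> prefix u w}
      \<subseteq> (\<lambda>z. u @ z) ` {z \<in> lists X. length z = a - length u}"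
    by (auto simp: prefix_def)
  then have "card {w \<in> lists X. length w = a \<and> prefix u w}
      \<le> card {z \<in> lists X. length z = a - length u}"
    using finite_words[OF assms(1)] by (meson surj_card_le)
  then show ?thesis by (simp add: card_words[OF assms(1)])
qed

text \<open>Union bound: the word \<open>v ! i\<close> rules out at most
  \<open>n ^ (a - L ! i)\<close> words of length \<open>a\<close>, a fraction
  \<open>1 / n ^ (L ! i)\<close> of them all.\<close>

lemma card_prefix_free_words:
  assumes "finite X" "card X > 0" "v \<in> codes X L" "\<And>b. b \<in> set L \<Longrightarrow> b \<le> a"
  shows "real (card {w \<in> lists X. length w = a \<and> (\<forall>i<length L. \<not> prefix (v ! i) w)})
    \<ge> real (card X) ^ a * (1 - kraft_sum (card X) L)"
proof -
  let ?W = "{w \<in> lists X. length w = a}"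
  let ?B = "\<lambda>i. {w \<in> lists X. length w = a \<and> prefix (v ! i) w}"
  let ?U = "\<Union>i<length L. ?B i"
  have len: "length (v ! i) = L ! i" "L ! i \<le> a" if "i < length L" for i
    using assms(3,4) that by (auto simp: codes_def)
  have "real (card ?U) \<le> (\<Sum>i<length L. real (card (?B i)))"
    using card_UN_le[of "{..<length L}" ?B] by (simp flip: of_nat_sum)
  also have "\<dots> \<le> (\<Sum>i<length L. real (card X) ^ a * (1 / real (card X) ^ (L ! i)))"
  proof (rule sum_mono)
    fix i assume "i \<in> {..<length L}"
    then have i: "i < length L" by simp
    have "real (card (?B i)) \<le> real (card X) ^ (a - L ! i)"
      using card_words_with_prefix[OF assms(1), of "v ! i" a] len[OF i]
      by (metis of_nat_le_iff of_nat_power)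
    also have "\<dots> = real (card X) ^ a * (1 / real (card X) ^ (L ! i))"
      using assms(2) len[OF i] by (simp add: power_diff)
    finally show "real (card (?B i)) \<le> \<dots>" .
  qed
  also have "\<dots> = real (card X) ^ a * kraft_sum (card X) L"
    by (simp add: kraft_sum_conv_sum sum_distrib_left)
  finally have U: "real (card ?U) \<le> real (card X) ^ a * kraft_sum (card X) L" .
  have "{w \<in> lists X. length w = a \<and> (\<forall>i<length L. \<not> prefix (v ! i) w)} = ?W - ?U" by auto
  moreover have "?U \<subseteq> ?W" by auto
  then have "card (?W - ?U) = card ?W - card ?U" "card ?U \<le> card ?W"
    using finite_words[OF assms(1), of a] by (auto intro: card_Diff_subset card_mono finite_subset)
  ultimately show ?thesis
    using U by (simp add: card_words[OF assms(1)] of_nat_diff algebra_simps)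
qed

text \<open>A word at least as long as all earlier ones can be a prefix of one of them only by being
  equal to it. Checking one direction is therefore enough, which is why lengths are processed in
  increasing order.\<close>

lemma prefix_code_snoc:
  assumes "prefix_code v" "w \<noteq> []" "\<And>u. u \<in> set v \<Longrightarrow> length u \<le> length w"
    and free: "\<And>i. i < length v \<Longrightarrow> \<not> prefix (v ! i) w"
  shows "prefix_code (v @ [w])"
proof -
  have nin: "w \<notin> set v" using free by (metis in_set_conv_nth prefix_order.refl)
  have free': "\<not> prefix w (v ! i)" if "i < length v" for i
    using free[OF that] assms(3)[OF nth_mem[OF that]]
    by (metis not_equal_is_parallel parallelE prefix_length_le le_antisym)
  show ?thesis
    unfolding prefix_code_def
  proof (intro conjI)
    show "\<forall>i<length (v @ [w]). \<forall>j<length (v @ [w]). i \<noteq> j \<longrightarrow>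
        \<not> prefix ((v @ [w]) ! i) ((v @ [w]) ! j)"
      using assms(1) free free' by (auto simp: prefix_code_def nth_append less_Suc_eq)
  qed (use assms(1,2) nin in \<open>auto simp: prefix_code_def\<close>)
qed

text \<open>Pairs of a prefix code and an admissible new word embed injectively into the longer
  prefix codes; the fibres are bounded by \<open>card_prefix_free_words\<close>.\<close>

lemma card_PR_snoc_ge:
  assumes "finite X" "card X > 0" "a > 0" "\<And>b. b \<in> set L \<Longrightarrow> b \<le> a"
  shows "real (card (PR X (L @ [a])))
    \<ge> real (card (PR X L)) * (real (card X) ^ a * (1 - kraft_sum (card X) L))"
proof -
  let ?F = "\<lambda>v. {w \<in> lists X. length w = a \<and> (\<forall>i<length L. \<not> prefix (v ! i) w)}"
  have finF: "finite (?F v)" for v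
    by (rule finite_subset[OF _ finite_words[OF assms(1), of a]]) auto
  have finPR: "finite (PR X M)" for M
    using finite_codes[OF assms(1)] by (simp add: PR_def)
  have sub: "(\<lambda>(v, w). v @ [w]) ` (SIGMA v : PR X L. ?F v) \<subseteq> PR X (L @ [a])"
  proof (rule subsetI)
    fix u assume "u \<in> (\<lambda>(v, w). v @ [w]) ` (SIGMA v : PR X L. ?F v)"
    then obtain v w where u: "u = v @ [w]" and v: "v \<in> PR X L"
      and w: "w \<in> lists X" "length w = a"
      and free: "\<forall>i<length L. \<not> prefix (v ! i) w" by (auto simp del: in_lists_conv_set)
    have vc: "v \<in> codes X L" "prefix_code v" using v by (auto simp: PR_def)
    then have "length v = length L" "\<And>i. i < length v \<Longrightarrow> length (v ! i) = L ! i"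
      by (auto simp: codes_def)
    then have "length u \<le> length w" if "u \<in> set v" for u
      using that assms(4) w by (metis in_set_conv_nth)
    then have "prefix_code (v @ [w])"
      using vc free assms(3) w \<open>length v = length L\<close> by (intro prefix_code_snoc) auto
    moreover have "v @ [w] \<in> codes X (L @ [a])"
      using vc w unfolding codes_snoc by (intro image_eqI[of _ _ "(v, w)"]) auto
    ultimately show "u \<in> PR X (L @ [a])" by (simp add: PR_def u)
  qed
  have "real (card (PR X L)) * (real (card X) ^ a * (1 - kraft_sum (card X) L))
      \<le> (\<Sum>v\<in>PR X L. real (card (?F v)))"
    unfolding sum_constant[symmetric]
    by (intro sum_mono card_prefix_free_words assms) (auto simp: PR_def)
  also have "\<dots> = real (card (SIGMA v : PR X L. ?F v))"
    using finPR finF by (simp add: card_SigmaI)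
  also have "\<dots> = real (card ((\<lambda>(v, w). v @ [w]) ` (SIGMA v : PR X L. ?F v)))"
    by (subst card_image) (auto simp: inj_on_def)
  also have "\<dots> \<le> real (card (PR X (L @ [a])))"
    using card_mono[OF finPR sub] by simp
  finally show ?thesis .
qed

text \<open>Iterates the one-word extension. The Kraft hypothesis passes to initial segments and
  keeps each factor \<open>c\<close> nonnegative, so the induction hypothesis may be multiplied by
  it.\<close>

lemma card_PR_sorted_ge:
  assumes "finite X" "card X > 0"
  shows "sorted L \<Longrightarrow> (\<forall>a\<in>set L. a > 0) \<Longrightarrow> kraft_sum (card X) L \<le> 1 \<Longrightarrow>
    real (card (PR X L)) \<ge> real (card X) ^ sum_list L *
      (\<Prod>i<length L. 1 - kraft_sum (card X) (take i L))"
proof (induction L rule: rev_induct)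
  case Nil
  have "PR X [] = {[]}" by (auto simp: PR_def prefix_code_def)
  then show ?case by simp
next
  case (snoc a L)
  define c where "c = real (card X) ^ a * (1 - kraft_sum (card X) L)"
  have le1: "kraft_sum (card X) L \<le> 1"
    using snoc.prems(3) by (simp add: order_trans[rotated])
  then have c0: "c \<ge> 0" unfolding c_def by simp
  have IH: "real (card X) ^ sum_list L * (\<Prod>i<length L. 1 - kraft_sum (card X) (take i L))
      \<le> real (card (PR X L))"
    using snoc le1 by (simp add: sorted_append)
  have "real (card X) ^ sum_list (L @ [a]) *
      (\<Prod>i<length (L @ [a]). 1 - kraft_sum (card X) (take i (L @ [a])))
      = real (card X) ^ sum_list L * (\<Prod>i<length L. 1 - kraft_sum (card X) (take i L)) * c"
    by (simp add: c_def power_add)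
  also have "\<dots> \<le> real (card (PR X L)) * c"
    using IH c0 by (rule mult_right_mono)
  also have "\<dots> \<le> real (card (PR X (L @ [a])))"
    unfolding c_def using snoc.prems
    by (intro card_PR_snoc_ge assms) (auto simp: sorted_append)
  finally show ?case .
qed

text \<open>Permuting the positions of the code words is injective and preserves the prefix
  property. This transfers the count for sorted lengths to \<open>L\<close> itself.\<close>

lemma card_PR_mset_mono:
  assumes "finite X" "mset M = mset L"
  shows "card (PR X L) \<le> card (PR X M)"
proof -
  obtain p where p: "p permutes {..<length L}" "permute_list p L = M"
    using mset_eq_permutation[OF assms(2)] by metis
  have inj: "inj_on (permute_list p) (PR X L)"
  proof (rule inj_onI)
    fix u v assume uv: "u \<in> PR X L" "v \<in> PR X L" "permute_list p u = permute_list p v"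
    then have len: "length u = length L" "length v = length L" by (auto simp: PR_def codes_def)
    show "u = v"
    proof (rule nth_equalityI)
      fix i assume "i < length u"
      then obtain j where "j < length L" "i = p j"
        using p(1) len by (metis permutes_image imageE lessThan_iff)
      then show "u ! i = v ! i"
        using uv(3) p(1) len permute_list_nth by metis
    qed (simp add: len)
  qed
  have "permute_list p v \<in> PR X M" if "v \<in> PR X L" for v
  proof -
    have len: "length v = length L" using that by (simp add: PR_def codes_def)
    have pv: "p permutes {..<length v}" using p len by simp
    have nth: "permute_list p v ! i = v ! p i" "M ! i = L ! p i" "p i < length L"
      if "i < length L" for i
      using that p len pv permute_list_nth[OF pv] permute_list_nth[OF p(1)]
        permutes_in_image[OF p(1), of i] by auto
    have lM: "length M = length L" using p by auto
    have "permute_list p v \<in> codes X M"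
      using \<open>v \<in> PR X L\<close> nth by (simp add: PR_def codes_def lM len)
    moreover have "prefix_code (permute_list p v)"
      using \<open>v \<in> PR X L\<close> pv nth permutes_inj[OF p(1)]
      unfolding PR_def prefix_code_def by (auto simp: len inj_eq)
    ultimately show ?thesis by (simp add: PR_def)
  qed
  then show ?thesis
    using inj finite_codes[OF assms(1)] by (intro card_inj_on_le) (auto simp: PR_def)
qed

text \<open>The number of all codes, \<open>n ^ sum_list L\<close>, bounds the denominator and is
  also a factor of the lower bound for the numerator, so it cancels.\<close>

lemma rho_ge_prod_gaps:
  assumes "finite X" "card X > 0" "\<forall>a\<in>set L. a > 0" "UD X L \<noteq> {}"
  shows "rho X L \<ge> (\<Prod>i<length L. 1 - kraft_sum (card X) (take i (sort L)))"
proof -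
  have k: "kraft_sum (card X) (sort L) \<le> 1"
    using McMillan_inequality[OF assms(1)] assms(4) kraft_sum_mset_cong[of "sort L" L]
    by fastforce
  let ?P = "\<Prod>i<length L. 1 - kraft_sum (card X) (take i (sort L))"
  have s: "sum_list (sort L) = sum_list L" by (metis mset_sort sum_mset_sum_list)
  have fin: "finite (UD X L)" using finite_codes[OF assms(1)] by (simp add: UD_def)
  have "card (UD X L) \<le> card X ^ sum_list L"
    unfolding card_codes[OF assms(1), symmetric]
    by (rule card_mono[OF finite_codes[OF assms(1)]]) (auto simp: UD_def)
  then have ud: "real (card (UD X L)) \<le> real (card X) ^ sum_list L"
    by (metis of_nat_le_iff of_nat_power)
  have "kraft_sum (card X) (take i (sort L)) \<le> 1" for i
    using k kraft_sum_append[of "card X" "take i (sort L)" "drop i (sort L)"]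
      kraft_sum_nonneg[of "card X" "drop i (sort L)"] by simp
  then have "?P \<ge> 0" by (intro prod_nonneg) simp
  then have "?P * real (card (UD X L)) \<le> real (card X) ^ sum_list L * ?P"
    using ud by (simp add: mult.commute mult_right_mono)
  also have "\<dots> \<le> real (card (PR X (sort L)))"
    using card_PR_sorted_ge[OF assms(1,2), of "sort L"] assms(3) k s by simp
  also have "\<dots> \<le> real (card (PR X L))"
    using card_PR_mset_mono[OF assms(1), of L "sort L"] by simp
  finally show ?thesis
    using fin assms(4) by (simp add: rho_def pos_le_divide_eq card_gt_0_iff)
qed

subsection \<open>Lower bounds for the Kraft gap\<close>

text \<open>In the greedy choice the word after the first \<open>k\<close> has length
  \<open>k div (n - 1) + 1\<close>, and its weight is what the gap loses.\<close>

lemma varsigma_Suc: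
  assumes "n \<ge> 2"
  shows "varsigma n (Suc k) = varsigma n k - 1 / real n ^ (k div (n - 1) + 1)"
\<comment> \<open>If the current length becomes full, the remainder wraps to 0 and the exponent
  rises: the numerator drops from 2 to 1, rewritten as \<open>n\<close> over one more power of
  \<open>n\<close>.\<close>
proof (cases "Suc (k mod (n - 1)) = n - 1")
  case True
  then have "Suc k mod (n - 1) = 0" "Suc k div (n - 1) = Suc (k div (n - 1))"
    by (auto simp: mod_Suc div_Suc)
  moreover have "real n - real (k mod (n - 1)) = 2" using True assms by linarith
  moreover have "real n / real n ^ (q + 2) = 2 / real n ^ (q + 1) - 1 / real n ^ (q + 1)" for q
    using assms by (simp add: divide_simps)
  ultimately show ?thesis
    unfolding varsigma_def by simp
next
  case False
  then have "Suc k mod (n - 1) = Suc (k mod (n - 1))" "Suc k div (n - 1) = k div (n - 1)"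
    by (auto simp: mod_Suc div_Suc)
  then show ?thesis unfolding varsigma_def by (simp add: diff_divide_distrib[symmetric])
qed

lemma varsigma_antimono:
  assumes "n \<ge> 2" "j \<le> k"
  shows "varsigma n k \<le> varsigma n j"
proof (rule lift_Suc_antimono_le[OF _ assms(2)])
  show "varsigma n (Suc i) \<le> varsigma n i" for i
    by (simp add: varsigma_Suc[OF assms(1)])
qed

lemma varsigma_nonneg:
  assumes "n \<ge> 2"
  shows "varsigma n k \<ge> 0"
proof -
  have "k mod (n - 1) < n - 1" using assms by simp
  then have "k mod (n - 1) \<le> n" by linarith
  then show ?thesis by (simp add: varsigma_def)
qed

text \<open>\<open>n ^ a\<close> is a common denominator. Integrality of the numerator turns a
  strictly positive gap into one of at least \<open>1 / n ^ a\<close>.\<close>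

lemma kraft_sum_multiple:
  assumes "n > 0" "\<And>b. b \<in> set L \<Longrightarrow> b \<le> a"
  shows "\<exists>c::int. kraft_sum n L = of_int c / real n ^ a"
  using assms(2)
proof (induction L)
  case Nil
  show ?case by (intro exI[of _ 0]) simp
next
  case (Cons b L)
  then obtain c :: int where "kraft_sum n L = of_int c / real n ^ a" by auto
  moreover have "real n ^ a = real n ^ b * real n ^ (a - b)"
    using Cons.prems[of b] by (simp flip: power_add)
  then have "1 / real n ^ b = of_int (int n ^ (a - b)) / real n ^ a"
    using assms(1) by simp
  ultimately have "kraft_sum n (b # L) = of_int (int n ^ (a - b) + c) / real n ^ a"
    by (simp add: add_divide_distrib)
  then show ?case by blast
qed

text \<open>
  If the last length \<open>a\<close> exceeds \<open>q = (k - 1) div (n - 1)\<close>, the gap shrinks by no more than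
  \<open>varsigma\<close> does; otherwise the gap is a positive multiple of \<open>1 / n ^ a \<ge> 1 / n ^ q\<close>.
\<close>

lemma kraft_gap_ge_varsigma:
  assumes "n \<ge> 2"
  shows "sorted L \<Longrightarrow> kraft_sum n L < 1 \<Longrightarrow> 1 - kraft_sum n L \<ge> varsigma n (length L)"
proof (induction L rule: rev_induct)
  case Nil
  show ?case using assms by (simp add: varsigma_def)
next
  case (snoc a L)
  define q where "q = length L div (n - 1)"
  have IH: "1 - kraft_sum n L \<ge> varsigma n (length L)"
    using snoc by (simp add: sorted_append order_le_less_trans[rotated])
  show ?case
  proof (cases "a \<ge> q + 1")
    case True
    then have "1 / real n ^ a \<le> 1 / real n ^ (q + 1)"
      using assms by (intro divide_left_mono power_increasing) auto
    then show ?thesis using IH by (simp add: varsigma_Suc[OF assms] q_def)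
  next
    case False
    obtain c :: int where c: "kraft_sum n (L @ [a]) = of_int c / real n ^ a"
      using kraft_sum_multiple[of n "L @ [a]" a] assms snoc.prems(1) by (auto simp: sorted_append)
    have pos: "real n ^ a > 0" using assms by simp
    have "of_int c < real n ^ a" using snoc.prems(2) pos unfolding c by simp
    then have "of_int c < (of_int (int n ^ a) :: real)" by simp
    then have "c + 1 \<le> int n ^ a" by linarith
    then have "of_int (c + 1) \<le> (of_int (int n ^ a) :: real)" by (rule of_int_le_iff[THEN iffD2])
    then have "1 / real n ^ a \<le> 1 - kraft_sum n (L @ [a])"
      unfolding c using divide_right_mono[of "of_int (c + 1)" "real n ^ a" "real n ^ a"] pos assms
      by (simp add: add_divide_distrib)
    moreover have "1 / real n ^ q \<le> 1 / real n ^ a"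
      using False assms by (intro divide_left_mono power_increasing) auto
    \<comment> \<open>Bounding the numerator by \<open>n\<close> gives
      \<open>varsigma n (length L) \<le> 1 / n ^ q\<close>, which closes the chain.\<close>
    moreover have "varsigma n (length L) \<le> real n / real n ^ (q + 1)"
      unfolding varsigma_def q_def by (intro divide_right_mono) auto
    moreover have "real n / real n ^ (q + 1) = 1 / real n ^ q" using assms by simp
    moreover have "varsigma n (length (L @ [a])) \<le> varsigma n (length L)"
      by (rule varsigma_antimono[OF assms]) simp
    ultimately show ?thesis by linarith
  qed
qed

section \<open>Distinct lengths\<close>

lemma sorted_distinct_nth_ge:
  assumes "sorted L" "distinct L" "\<forall>a\<in>set L. a > 0" "i < length L"
  shows "L ! i \<ge> Suc i"
  using assms(4)
proof (induction i)
  case 0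
  then show ?case using assms(3) by (simp add: Suc_leI)
next
  case (Suc i)
  have "L ! i < L ! Suc i"
    using Suc.prems assms(1,2) by (meson sorted_wrt_nth_less strict_sorted_iff lessI)
  then show ?case using Suc by simp
qed

lemma sum_inverse_powers:
  assumes "n \<ge> 2"
  shows "(\<Sum>j<k. 1 / real n ^ Suc j) = (1 - 1 / real n ^ k) / (real n - 1)"
proof (induction k)
  case (Suc k)
  then show ?case using assms by (simp add: divide_simps) (simp add: algebra_simps)
qed simp

text \<open>In 0-based indexing the entry at \<open>i\<close> is at least \<open>i + 1\<close>, so
  the sum is dominated termwise by a geometric one.\<close>

lemma kraft_sum_distinct_le:
  assumes "n \<ge> 2" "sorted L" "distinct L" "\<forall>a\<in>set L. a > 0"
  shows "kraft_sum n L \<le> (1 - 1 / real n ^ length L) / (real n - 1)"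
  unfolding sum_inverse_powers[OF assms(1), symmetric] kraft_sum_conv_sum
proof (rule sum_mono)
  fix i assume "i \<in> {..<length L}"
  then have "Suc i \<le> L ! i" using sorted_distinct_nth_ge[OF assms(2-4)] by simp
  then show "1 / real n ^ (L ! i) \<le> 1 / real n ^ Suc i"
    using assms(1) by (intro divide_left_mono power_increasing) auto
qed

text \<open>From \<open>k! \<le> k ^ k\<close> with \<open>k = m - 1\<close>; it lets the factor
  \<open>q_coeff n m\<close> be inserted into a nonnegative lower bound.\<close>

lemma q_coeff_le_one: "q_coeff n m \<le> 1"
proof -
  have "(fact (m - 1) :: real) \<le> real (m - 1) ^ (m - 1)"
    using fact_le_power[of "m - 1", where 'a = real] by simp
  moreover from this have "real (m - 1) ^ (m - 1) > 0"
    using fact_gt_zero less_le_trans by blast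
  ultimately show ?thesis
    unfolding q_coeff_def by (auto simp: divide_le_eq_1 simp del: of_nat_diff)
qed

section \<open>Combining the gap bounds\<close>

theorem theorem2:
  fixes X :: "'a set" and n m :: nat and L :: "nat list"
  assumes "finite X" and "card X = n"
    and "n \<ge> 2" and "m \<ge> 1"
    and "L \<in> length_distributions X m"
  shows "rho X L \<ge> q_coeff n m * varsigma n m ^ (m - 1) \<and>
    (distinct L \<longrightarrow> rho X L \<ge> varpi n m)"
proof -
  define S where "S = sort L"
  have L: "length L = m" "\<forall>a\<in>set L. a > 0" "UD X L \<noteq> {}"
    using assms(5) by (auto simp: length_distributions_def)
  have S: "sorted S" "length S = m" "\<forall>a\<in>set S. a > 0" using L by (auto simp: S_def)
  have kS: "kraft_sum n S \<le> 1"
    using McMillan_inequality[OF assms(1)] L(3) kraft_sum_mset_cong[of S L] assms(2)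
    by (fastforce simp: S_def)
  let ?g = "\<lambda>i. 1 - kraft_sum n (take i S)"
  \<comment> \<open>The gap before the first word is 1. Removing it leaves \<open>m - 1\<close>
    factors, matching the exponent \<open>m - 1\<close> and the range in
    \<open>varpi\<close>.\<close>
  have "{..<m} = insert 0 {1..m - 1}" using assms(4) by auto
  then have "(\<Prod>i<m. ?g i) = (\<Prod>i = 1..m - 1. ?g i)" by simp
  then have rho: "rho X L \<ge> (\<Prod>i = 1..m - 1. ?g i)"
    using rho_ge_prod_gaps[of X L] assms L by (simp add: S_def)
  \<comment> \<open>Strict because \<open>S ! i\<close> is left out and carries positive weight in a
    total of at most 1; \<open>kraft_gap_ge_varsigma\<close> requires this.\<close>
  have less: "kraft_sum n (take i S) < 1" if "i < m" for i
  proof -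
    have "S = take i S @ S ! i # drop (Suc i) S" using that S by (simp add: id_take_nth_drop)
    then have "kraft_sum n S = kraft_sum n (take i S) +
        (1 / real n ^ (S ! i) + kraft_sum n (drop (Suc i) S))"
      by (metis kraft_sum_append kraft_sum_Cons)
    moreover have "1 / real n ^ (S ! i) > 0" using assms(3) by simp
    ultimately show ?thesis using kS kraft_sum_nonneg[of n "drop (Suc i) S"] by linarith
  qed
  \<comment> \<open>Antimonotonicity replaces \<open>varsigma n i\<close> by
    \<open>varsigma n m\<close>, a bound common to all factors.\<close>
  have "?g i \<ge> varsigma n m" if "i < m" for i
    using kraft_gap_ge_varsigma[OF assms(3), of "take i S"] less[OF that] S that
      varsigma_antimono[OF assms(3), of i m] sorted_wrt_take[of "(\<le>)" S i] by simp
  then have "(\<Prod>i = 1..m - 1. varsigma n m) \<le> (\<Prod>i = 1..m - 1. ?g i)"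
    using varsigma_nonneg[OF assms(3)] assms(4) by (intro prod_mono) auto
  then have "varsigma n m ^ (m - 1) \<le> rho X L" using rho by simp
  moreover have "q_coeff n m * varsigma n m ^ (m - 1) \<le> 1 * varsigma n m ^ (m - 1)"
    using q_coeff_le_one varsigma_nonneg[OF assms(3)] by (intro mult_right_mono) auto
  moreover have "rho X L \<ge> varpi n m" if d: "distinct L"
  proof -
    have "varpi n m \<le> (\<Prod>i = 1..m - 1. ?g i)"
      unfolding varpi_def
    proof (rule prod_mono)
      fix i assume "i \<in> {1..m - 1}"
      then have i: "i < m" by auto
      \<comment> \<open>\<open>prod_mono\<close> also needs the factors of \<open>varpi\<close> to
        be nonnegative; this is where \<open>n \<ge> 2\<close> enters.\<close>
      have "1 - 1 / real n ^ i \<le> 1" by simp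
      also have "1 \<le> real n - 1" using assms(3) by simp
      finally have "1 - 1 / real n ^ i \<le> real n - 1" .
      then have "(1 - 1 / real n ^ i) / (real n - 1) \<le> 1"
        using assms(3) by (simp add: divide_le_eq_1)
      moreover have "kraft_sum n (take i S) \<le> (1 - 1 / real n ^ i) / (real n - 1)"
        using kraft_sum_distinct_le[OF assms(3), of "take i S"] S d i set_take_subset[of i S]
          sorted_wrt_take[OF S(1), of i] by (auto simp: S_def subset_iff)
      ultimately show "0 \<le> 1 - (1 - 1 / real n ^ i) / (real n - 1) \<and>
          1 - (1 - 1 / real n ^ i) / (real n - 1) \<le> ?g i" by simp
    qed
    then show ?thesis using rho by simp
  qed
  ultimately show ?thesis by simp
qed

end
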